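(* Let $m\geq 1$ be an integer, let $\boldsymbol{r}_{j}=(r_{1j},r_{2j})^{T}\in\mathbb{R}^{2}$ be given points and let $w_{j},d_{j}\in\mathbb{R}$ with $d_{j}\geq 0$ for $j=1,\ldots,m$, and let $s,t\in\mathbb{R}$ with $s\leq t$. Consider the problem of finding all $(x_{1},x_{2})^{T}\in\mathbb{R}^{2}$ that $$ \text{minimize}\quad \max_{1\leq j\leq m}(|x_{1}-r_{1j}|+|x_{2}-r_{2j}|+w_{j}) $$ $$ \text{subject to}\quad |x_{1}-r_{1j}|+|x_{2}-r_{2j}|\leq d_{j},\quad j=1,\ldots,m;\qquad s\leq x_{1}\leq t. $$ Define \begin{align*} p_{1}&=\max_{1\leq j\leq m}(w_{j}+r_{1j}+r_{2j}), & p_{2}&=\max_{1\leq j\leq m}(w_{j}-r_{1j}+r_{2j}),\\ q_{1}&=\min_{1\leq j\leq m}(-w_{j}+r_{1j}+r_{2j}), & q_{2}&=\min_{1\leq j\leq m}(-w_{j}-r_{1j}+r_{2j}),\\ g_{1}&=\max_{1\leq j\leq m}(-d_{j}+r_{1j}+r_{2j}), & g_{2}&=\max_{1\leq j\leq m}(-d_{j}-r_{1j}+r_{2j}),\\ h_{1}&=\min_{1\leq j\leq m}(d_{j}+r_{1j}+r_{2j}), & h_{2}&=\min_{1\leq j\leq m}(d_{j}-r_{1j}+r_{2j}), \end{align*} and suppose that $$ \max(g_{1}-h_{1},\ g_{1}-h_{2}-2t,\ g_{2}-h_{1}+2s,\ g_{2}-h_{2})\leq 0. $$ Then the minimum value in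 the problem is equal to \begin{align*} \theta=\max\bigl(&(p_{1}-q_{1})/2,\ (p_{1}-q_{2})/2-t,\ (p_{2}-q_{1})/2+s,\ (p_{2}-q_{2})/2,\\ &p_{1}-h_{1},\ p_{1}-h_{2}-2t,\ p_{2}-h_{1}+2s,\ p_{2}-h_{2},\\ &g_{1}-q_{1},\ g_{1}-q_{2}-2t,\ g_{2}-q_{1}+2s,\ g_{2}-q_{2}\bigr), \end{align*} and all solutions (i.e. exactly the set of minimizers) are given by \begin{align*} x_{1}&=\max(u_{1},u_{2}+2s)/2-\max(u_{1}-2t,u_{2})/2,\\ x_{2}&=\max(u_{1},u_{2}+2s)/2+\max(u_{1}-2t,u_{2})/2, \end{align*} where \begin{align*} u_{1}&=(1-\alpha)\max(g_{1},p_{1}-\theta)+\alpha\min(h_{1},\ q_{1}+\theta,\ h_{2}+2t,\ q_{2}+2t+\theta),\\ u_{2}&=(1-\alpha)\max(g_{2},p_{2}-\theta)+\alpha\min(h_{1}-2s,\ q_{1}-2s+\theta,\ h_{2},\ q_{2}+\theta) \end{align*} for all real $\alpha$ such that $0\leq\alpha\leq 1$.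
   Context: All operations are in conventional real arithmetic. "Solutions" of the problem are the feasible points at which the minimum of the objective function over the feasible set is attained; the same parameter $\alpha$ is used in both $u_{1}$ and $u_{2}$, and the solution set is obtained as $\alpha$ ranges over $[0,1]$. *)

theory Defs
  imports "HOL-Analysis.Analysis"
begin

definition objective :: "nat \<Rightarrow> (nat \<Rightarrow> real ^ 2) \<Rightarrow> (nat \<Rightarrow> real) \<Rightarrow> real ^ 2 \<Rightarrow> real" where
  "objective m r w x = (MAX j\<in>{1..m}. \<bar>x $ 1 - r j $ 1\<bar> + \<bar>x $ 2 - r j $ 2\<bar> + w j)"

definition feasible :: "nat \<Rightarrow> (nat \<Rightarrow> real ^ 2) \<Rightarrow> (nat \<Rightarrow> real) \<Rightarrow> real \<Rightarrow> real \<Rightarrow> (real ^ 2) set" where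
  "feasible m r d s t =
     {x. (\<forall>j\<in>{1..m}. \<bar>x $ 1 - r j $ 1\<bar> + \<bar>x $ 2 - r j $ 2\<bar> \<le> d j) \<and> s \<le> x $ 1 \<and> x $ 1 \<le> t}"

text \<open>The value must be attained, so this is stronger than being the infimum.\<close>

definition is_minimum_value :: "('a \<Rightarrow> real) \<Rightarrow> 'a set \<Rightarrow> real \<Rightarrow> bool" where
  "is_minimum_value f S v \<longleftrightarrow> (\<exists>x\<in>S. f x = v) \<and> (\<forall>x\<in>S. v \<le> f x)"

definition minimizers :: "('a \<Rightarrow> real) \<Rightarrow> 'a set \<Rightarrow> 'a set" where
  "minimizers f S = {x. is_arg_min f (\<lambda>y. y \<in> S) x}"

end

theory Submission
  imports Defs
begin

text \<open>
  In the coordinates \<open>y\<^sub>1 = x\<^sub>1 + x\<^sub>2\<close>, \<open>y\<^sub>2 = x\<^sub>2 - x\<^sub>1\<close> rectilinear balls become squares, so the feasible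
  points of objective at most \<open>c\<close> form the intersection of a box with the strip
  \<open>2 s \<le> y\<^sub>1 - y\<^sub>2 \<le> 2 t\<close>. Such an intersection \<open>{a \<le> y \<le> b}\<close> is nonempty iff \<open>a\<^sub>1 \<le> min b\<^sub>1 (b\<^sub>2 + 2 t)\<close> and
  \<open>a\<^sub>2 \<le> min b\<^sub>2 (b\<^sub>1 - 2 s)\<close>, and the least \<open>c\<close> for which this holds is \<open>\<theta>\<close>. At \<open>c = \<theta>\<close> one of the two
  inequalities is an equality, so one of \<open>u1\<close>, \<open>u2\<close> is constant; this is why a single parameter
  \<open>\<alpha>\<close> suffices to reach all minimizers.
\<close>

text \<open>For reals p and q, the sum of absolute values of p and q is the largest of p + q, p - q,
  -p + q and -p - q. Bounding all four bounds each rotated coordinate from both sides.\<close>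

lemma l1_dist_le_iff:
  fixes x y a b c :: real
  shows "\<bar>x - a\<bar> + \<bar>y - b\<bar> \<le> c \<longleftrightarrow>
    - c + a + b \<le> x + y \<and> x + y \<le> c + a + b \<and> - c - a + b \<le> y - x \<and> y - x \<le> c - a + b"
  by (auto simp: abs_if)

lemma l1_dists_le_iff:
  fixes x y :: real and a b e :: "'i \<Rightarrow> real"
  assumes "finite J" "J \<noteq> {}"
  shows "(\<forall>j\<in>J. \<bar>x - a j\<bar> + \<bar>y - b j\<bar> \<le> e j) \<longleftrightarrow>
    (MAX j\<in>J. - e j + a j + b j) \<le> x + y \<and> x + y \<le> (MIN j\<in>J. e j + a j + b j) \<and>
    (MAX j\<in>J. - e j - a j + b j) \<le> y - x \<and> y - x \<le> (MIN j\<in>J. e j - a j + b j)"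
  using assms by (auto simp: l1_dist_le_iff)

lemma MAX_l1_dist_plus_le_iff:
  fixes x y c :: real and a b w :: "'i \<Rightarrow> real"
  assumes "finite J" "J \<noteq> {}"
  shows "(MAX j\<in>J. \<bar>x - a j\<bar> + \<bar>y - b j\<bar> + w j) \<le> c \<longleftrightarrow>
    (MAX j\<in>J. w j + a j + b j) - c \<le> x + y \<and> x + y \<le> (MIN j\<in>J. - w j + a j + b j) + c \<and>
    (MAX j\<in>J. w j - a j + b j) - c \<le> y - x \<and> y - x \<le> (MIN j\<in>J. - w j - a j + b j) + c"
proof -
  have "(MAX j\<in>J. \<bar>x - a j\<bar> + \<bar>y - b j\<bar> + w j) \<le> c \<longleftrightarrow>
      (\<forall>j\<in>J. \<bar>x - a j\<bar> + \<bar>y - b j\<bar> \<le> c - w j)"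
    using assms by (auto simp: algebra_simps)
  \<comment> \<open>Each inequality now has everything that depends on \<open>j\<close> on one side
    and \<open>c\<close> on the other, so the quantifiers turn into extrema that do not involve
    \<open>c\<close>.\<close>
  also have "\<dots> \<longleftrightarrow> (\<forall>j\<in>J. w j + a j + b j \<le> x + y + c) \<and> (\<forall>j\<in>J. x + y - c \<le> - w j + a j + b j) \<and>
      (\<forall>j\<in>J. w j - a j + b j \<le> y - x + c) \<and> (\<forall>j\<in>J. y - x - c \<le> - w j - a j + b j)"
    unfolding l1_dist_le_iff by (auto simp: algebra_simps)
  also have "\<dots> \<longleftrightarrow> (MAX j\<in>J. w j + a j + b j) \<le> x + y + c \<and> x + y - c \<le> (MIN j\<in>J. - w j + a j + b j) \<and>
      (MAX j\<in>J. w j - a j + b j) \<le> y - x + c \<and> y - x - c \<le> (MIN j\<in>J. - w j - a j + b j)"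
    using assms by auto
  finally show ?thesis
    by (simp add: algebra_simps)
qed

lemma between_obtain_convex_combination:
  fixes a c y :: real
  assumes "a \<le> y" "y \<le> c"
  obtains \<alpha> where "0 \<le> \<alpha>" "\<alpha> \<le> 1" "y = (1 - \<alpha>) * a + \<alpha> * c"
proof -
  have "y \<in> closed_segment a c"
    using assms closed_segment_eq_real_ivl[of a c] by simp
  then show thesis
    using that by (auto simp: closed_segment_def)
qed

lemma convex_combination_between:
  fixes a c \<alpha> :: real
  assumes "a \<le> c" "0 \<le> \<alpha>" "\<alpha> \<le> 1"
  shows "a \<le> (1 - \<alpha>) * a + \<alpha> * c" "(1 - \<alpha>) * a + \<alpha> * c \<le> c"
  using closed_segment_eq_real_ivl[of a c] assms by (auto simp: closed_segment_def)

lemma box_strip_iff_parametrization: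
  fixes a1 a2 b1 b2 s t y1 y2 :: real
  defines "c1 \<equiv> min b1 (b2 + 2 * t)" and "c2 \<equiv> min b2 (b1 - 2 * s)"
  defines "v1 \<equiv> \<lambda>\<alpha>. (1 - \<alpha>) * a1 + \<alpha> * c1" and "v2 \<equiv> \<lambda>\<alpha>. (1 - \<alpha>) * a2 + \<alpha> * c2"
  assumes "s \<le> t" and le: "a1 \<le> c1" "a2 \<le> c2" and tight: "c1 \<le> a1 \<or> c2 \<le> a2"
  shows "a1 \<le> y1 \<and> y1 \<le> b1 \<and> a2 \<le> y2 \<and> y2 \<le> b2 \<and> 2 * s \<le> y1 - y2 \<and> y1 - y2 \<le> 2 * t \<longleftrightarrow>
    (\<exists>\<alpha>. 0 \<le> \<alpha> \<and> \<alpha> \<le> 1 \<and> y1 = max (v1 \<alpha>) (v2 \<alpha> + 2 * s) \<and> y2 = max (v1 \<alpha> - 2 * t) (v2 \<alpha>))"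
    (is "?L \<longleftrightarrow> ?R")
proof
  assume L: ?L
  then have y: "a1 \<le> y1" "y1 \<le> c1" "a2 \<le> y2" "y2 \<le> c2"
    unfolding c1_def c2_def by linarith+
  from tight show ?R
  proof
    assume "c1 \<le> a1"
    obtain \<alpha> where \<alpha>: "0 \<le> \<alpha>" "\<alpha> \<le> 1" and y2: "y2 = v2 \<alpha>"
      using between_obtain_convex_combination[OF y(3,4)] unfolding v2_def by metis
    have "y1 = v1 \<alpha>"
      using \<open>c1 \<le> a1\<close> y(1,2) convex_combination_between[OF le(1) \<alpha>] unfolding v1_def by linarith
    \<comment> \<open>Since y satisfies the strip constraints,
      \<open>v2 \<alpha> + 2 * s \<le> v1 \<alpha>\<close> and
      \<open>v1 \<alpha> - 2 * t \<le> v2 \<alpha>\<close>, so the maxima return y itself.\<close>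
    with \<alpha> y2 L show ?R
      by (intro exI[of _ \<alpha>]) auto
  next
    assume "c2 \<le> a2"
    obtain \<alpha> where \<alpha>: "0 \<le> \<alpha>" "\<alpha> \<le> 1" and y1: "y1 = v1 \<alpha>"
      using between_obtain_convex_combination[OF y(1,2)] unfolding v1_def by metis
    have "y2 = v2 \<alpha>"
      using \<open>c2 \<le> a2\<close> y(3,4) convex_combination_between[OF le(2) \<alpha>] unfolding v2_def by linarith
    with \<alpha> y1 L show ?R
      by (intro exI[of _ \<alpha>]) auto
  qed
next
  assume ?R
  then obtain \<alpha> where \<alpha>: "0 \<le> \<alpha>" "\<alpha> \<le> 1"
    and y: "y1 = max (v1 \<alpha>) (v2 \<alpha> + 2 * s)" "y2 = max (v1 \<alpha> - 2 * t) (v2 \<alpha>)"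
    by blast
  have "a1 \<le> v1 \<alpha>" "v1 \<alpha> \<le> c1" "a2 \<le> v2 \<alpha>" "v2 \<alpha> \<le> c2"
    using convex_combination_between[OF le(1) \<alpha>] convex_combination_between[OF le(2) \<alpha>]
    unfolding v1_def v2_def by auto
  then have "a1 \<le> v1 \<alpha>" "v1 \<alpha> \<le> b1" "v1 \<alpha> \<le> b2 + 2 * t" "a2 \<le> v2 \<alpha>" "v2 \<alpha> \<le> b2" "v2 \<alpha> \<le> b1 - 2 * s"
    unfolding c1_def c2_def by auto
  \<comment> \<open>The point (\<open>v1 \<alpha>\<close>, \<open>v2 \<alpha>\<close>) lies in the
    box but may miss the strip. The maxima raise one coordinate onto the violated edge, and the
    bounds by \<open>c1\<close> and \<open>c2\<close> keep the raised coordinate below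
    \<open>b1\<close> or \<open>b2\<close>.\<close>
  with \<open>s \<le> t\<close> y show ?L
    by (auto simp: max_def)
qed

text \<open>Once a lower bound is reached at a feasible point, the minimizers are a sublevel set.
  Both claims of the theorem thus reduce to describing the feasible points of objective at most
  \<theta>.\<close>

lemma minimum_value_and_minimizers_sublevel:
  fixes f :: "'a \<Rightarrow> real"
  assumes lower: "\<And>x. x \<in> S \<Longrightarrow> v \<le> f x" and "x\<^sub>0 \<in> S" "f x\<^sub>0 \<le> v"
  shows "is_minimum_value f S v" and "minimizers f S = {x \<in> S. f x \<le> v}"
proof -
  have "f x\<^sub>0 = v"
    using assms by (simp add: order_antisym)
  with assms show "is_minimum_value f S v"
    unfolding is_minimum_value_def by blast
  show "minimizers f S = {x \<in> S. f x \<le> v}"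
    using lower \<open>x\<^sub>0 \<in> S\<close> \<open>f x\<^sub>0 = v\<close>
    unfolding minimizers_def is_arg_min_def by (force simp: not_less)
qed

theorem theorem5:
  fixes m :: nat
    and r :: "nat \<Rightarrow> real ^ 2"
    and w d :: "nat \<Rightarrow> real"
    and s t p1 p2 q1 q2 g1 g2 h1 h2 \<theta> :: real
    and u1 u2 :: "real \<Rightarrow> real"
  assumes "m \<ge> 1"
    and "\<forall>j\<in>{1..m}. d j \<ge> 0"
    and "s \<le> t"
    and p1: "p1 = (MAX j\<in>{1..m}. w j + r j $ 1 + r j $ 2)"
    and p2: "p2 = (MAX j\<in>{1..m}. w j - r j $ 1 + r j $ 2)"
    and q1: "q1 = (MIN j\<in>{1..m}. - w j + r j $ 1 + r j $ 2)"
    and q2: "q2 = (MIN j\<in>{1..m}. - w j - r j $ 1 + r j $ 2)"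
    and g1: "g1 = (MAX j\<in>{1..m}. - d j + r j $ 1 + r j $ 2)"
    and g2: "g2 = (MAX j\<in>{1..m}. - d j - r j $ 1 + r j $ 2)"
    and h1: "h1 = (MIN j\<in>{1..m}. d j + r j $ 1 + r j $ 2)"
    and h2: "h2 = (MIN j\<in>{1..m}. d j - r j $ 1 + r j $ 2)"
    and "Max {g1 - h1, g1 - h2 - 2 * t, g2 - h1 + 2 * s, g2 - h2} \<le> 0"
    and \<theta>: "\<theta> = Max {(p1 - q1) / 2, (p1 - q2) / 2 - t, (p2 - q1) / 2 + s, (p2 - q2) / 2,
                p1 - h1, p1 - h2 - 2 * t, p2 - h1 + 2 * s, p2 - h2,
                g1 - q1, g1 - q2 - 2 * t, g2 - q1 + 2 * s, g2 - q2}"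
    and u1: "\<And>\<alpha>. u1 \<alpha> = (1 - \<alpha>) * max g1 (p1 - \<theta>)
                + \<alpha> * Min {h1, q1 + \<theta>, h2 + 2 * t, q2 + 2 * t + \<theta>}"
    and u2: "\<And>\<alpha>. u2 \<alpha> = (1 - \<alpha>) * max g2 (p2 - \<theta>)
                + \<alpha> * Min {h1 - 2 * s, q1 - 2 * s + \<theta>, h2, q2 + \<theta>}"
  shows "is_minimum_value (objective m r w) (feasible m r d s t) \<theta> \<and>
         minimizers (objective m r w) (feasible m r d s t) =
           {x. \<exists>\<alpha>. 0 \<le> \<alpha> \<and> \<alpha> \<le> 1 \<and>
              x $ 1 = max (u1 \<alpha>) (u2 \<alpha> + 2 * s) / 2 - max (u1 \<alpha> - 2 * t) (u2 \<alpha>) / 2 \<and>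
              x $ 2 = max (u1 \<alpha>) (u2 \<alpha> + 2 * s) / 2 + max (u1 \<alpha> - 2 * t) (u2 \<alpha>) / 2}"
proof -
  define a1 a2 b1 b2 where "a1 = max g1 (p1 - \<theta>)" and "a2 = max g2 (p2 - \<theta>)"
    and "b1 = min h1 (q1 + \<theta>)" and "b2 = min h2 (q2 + \<theta>)"
  define c1 c2 where "c1 = min b1 (b2 + 2 * t)" and "c2 = min b2 (b1 - 2 * s)"
  let ?f = "objective m r w" and ?S = "feasible m r d s t"
  have J: "finite {1..m}" "{1..m} \<noteq> {}"
    using \<open>m \<ge> 1\<close> by auto
  have feasible_iff: "x \<in> ?S \<longleftrightarrow> g1 \<le> x $ 1 + x $ 2 \<and> x $ 1 + x $ 2 \<le> h1 \<and>
      g2 \<le> x $ 2 - x $ 1 \<and> x $ 2 - x $ 1 \<le> h2 \<and> s \<le> x $ 1 \<and> x $ 1 \<le> t" for x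
    unfolding feasible_def mem_Collect_eq l1_dists_le_iff[OF J] g1 g2 h1 h2 by blast
  have objective_le_iff: "?f x \<le> c \<longleftrightarrow> p1 - c \<le> x $ 1 + x $ 2 \<and> x $ 1 + x $ 2 \<le> q1 + c \<and>
      p2 - c \<le> x $ 2 - x $ 1 \<and> x $ 2 - x $ 1 \<le> q2 + c" for x c
    unfolding objective_def p1 p2 q1 q2 by (rule MAX_l1_dist_plus_le_iff[OF J])
  have gh: "g1 \<le> h1" "g1 \<le> h2 + 2 * t" "g2 \<le> h1 - 2 * s" "g2 \<le> h2"
    using assms(12) by auto
  have \<theta>_ge: "(p1 - q1) / 2 \<le> \<theta>" "(p1 - q2) / 2 - t \<le> \<theta>" "(p2 - q1) / 2 + s \<le> \<theta>" "(p2 - q2) / 2 \<le> \<theta>"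
      "p1 - h1 \<le> \<theta>" "p1 - h2 - 2 * t \<le> \<theta>" "p2 - h1 + 2 * s \<le> \<theta>" "p2 - h2 \<le> \<theta>"
      "g1 - q1 \<le> \<theta>" "g1 - q2 - 2 * t \<le> \<theta>" "g2 - q1 + 2 * s \<le> \<theta>" "g2 - q2 \<le> \<theta>"
    unfolding \<theta> by (rule Max_ge; simp)+
  have \<theta>_cases: "\<theta> \<in> {(p1 - q1) / 2, (p1 - q2) / 2 - t, (p2 - q1) / 2 + s, (p2 - q2) / 2,
      p1 - h1, p1 - h2 - 2 * t, p2 - h1 + 2 * s, p2 - h2,
      g1 - q1, g1 - q2 - 2 * t, g2 - q1 + 2 * s, g2 - q2}"
    by (subst \<theta>, rule Max_in) auto
  have a: "g1 \<le> a1" "p1 - \<theta> \<le> a1" "g2 \<le> a2" "p2 - \<theta> \<le> a2"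
    unfolding a1_def a2_def by auto
  have c: "c1 \<le> h1" "c1 \<le> q1 + \<theta>" "c1 \<le> h2 + 2 * t" "c1 \<le> q2 + \<theta> + 2 * t"
      "c2 \<le> h2" "c2 \<le> q2 + \<theta>" "c2 \<le> h1 - 2 * s" "c2 \<le> q1 + \<theta> - 2 * s"
    unfolding c1_def c2_def b1_def b2_def by linarith+
  \<comment> \<open>Expanding the extrema gives sixteen comparisons: the four between some g and
    some h are \<open>gh\<close>, the other twelve are \<open>\<theta>_ge\<close>. The halves arise
    where \<theta> occurs on both sides, as in
    \<open>p1 - \<theta> \<le> q1 + \<theta>\<close>.\<close>
  have le: "a1 \<le> c1" "a2 \<le> c2"
    using gh \<theta>_ge
    unfolding a1_def a2_def b1_def b2_def c1_def c2_def diff_divide_distrib by linarith+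
  \<comment> \<open>The term that attains \<theta> turns one of those twelve comparisons into an
    equality. Terms with \<open>p1\<close> or \<open>g1\<close> give the first alternative, those
    with \<open>p2\<close> or \<open>g2\<close> the second.\<close>
  have tight: "c1 \<le> a1 \<or> c2 \<le> a2"
    using \<theta>_cases a c by (auto simp: diff_divide_distrib)
  have u: "u1 \<alpha> = (1 - \<alpha>) * a1 + \<alpha> * c1" "u2 \<alpha> = (1 - \<alpha>) * a2 + \<alpha> * c2" for \<alpha>
  proof -
    have "Min {h1, q1 + \<theta>, h2 + 2 * t, q2 + 2 * t + \<theta>} = c1"
      by (simp add: c1_def b1_def b2_def min_def)
    moreover have "Min {h1 - 2 * s, q1 - 2 * s + \<theta>, h2, q2 + \<theta>} = c2"
      by (simp add: c2_def b1_def b2_def min_def)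
    ultimately show "u1 \<alpha> = (1 - \<alpha>) * a1 + \<alpha> * c1" "u2 \<alpha> = (1 - \<alpha>) * a2 + \<alpha> * c2"
      by (simp_all add: u1 u2 a1_def a2_def)
  qed
  have sublevel: "x \<in> ?S \<and> ?f x \<le> \<theta> \<longleftrightarrow> (\<exists>\<alpha>. 0 \<le> \<alpha> \<and> \<alpha> \<le> 1 \<and>
      x $ 1 = max (u1 \<alpha>) (u2 \<alpha> + 2 * s) / 2 - max (u1 \<alpha> - 2 * t) (u2 \<alpha>) / 2 \<and>
      x $ 2 = max (u1 \<alpha>) (u2 \<alpha> + 2 * s) / 2 + max (u1 \<alpha> - 2 * t) (u2 \<alpha>) / 2)" for x
  proof -
    have rotate: "a + b = A \<and> b - a = B \<longleftrightarrow> a = A / 2 - B / 2 \<and> b = A / 2 + B / 2" for a b A B :: real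
      by linarith
    let ?y1 = "x $ 1 + x $ 2" and ?y2 = "x $ 2 - x $ 1"
    \<comment> \<open>As \<open>?y1 - ?y2\<close> is twice \<open>x $ 1\<close>, the bounds
      \<open>s\<close> and \<open>t\<close> become the strip.\<close>
    have "x \<in> ?S \<and> ?f x \<le> \<theta> \<longleftrightarrow> a1 \<le> ?y1 \<and> ?y1 \<le> b1 \<and> a2 \<le> ?y2 \<and> ?y2 \<le> b2 \<and>
        2 * s \<le> ?y1 - ?y2 \<and> ?y1 - ?y2 \<le> 2 * t"
      unfolding feasible_iff objective_le_iff a1_def a2_def b1_def b2_def by auto
    also have "\<dots> \<longleftrightarrow> (\<exists>\<alpha>. 0 \<le> \<alpha> \<and> \<alpha> \<le> 1 \<and> ?y1 = max (u1 \<alpha>) (u2 \<alpha> + 2 * s) \<and>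
        ?y2 = max (u1 \<alpha> - 2 * t) (u2 \<alpha>))"
      unfolding u c1_def c2_def
      by (rule box_strip_iff_parametrization) (use \<open>s \<le> t\<close> le tight in \<open>simp_all only: c1_def c2_def\<close>)
    also have "\<dots> \<longleftrightarrow> (\<exists>\<alpha>. 0 \<le> \<alpha> \<and> \<alpha> \<le> 1 \<and>
        x $ 1 = max (u1 \<alpha>) (u2 \<alpha> + 2 * s) / 2 - max (u1 \<alpha> - 2 * t) (u2 \<alpha>) / 2 \<and>
        x $ 2 = max (u1 \<alpha>) (u2 \<alpha> + 2 * s) / 2 + max (u1 \<alpha> - 2 * t) (u2 \<alpha>) / 2)"
      by (simp only: rotate)
    finally show ?thesis .
  qed
  \<comment> \<open>With \<open>c = ?f x\<close>, each of the twelve terms is at most c: chain a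
    lower bound on one rotated coordinate with an upper bound on the same one, or on the other one
    through the strip.\<close>
  have lower: "\<theta> \<le> ?f x" if "x \<in> ?S" for x
    using \<theta>_cases that objective_le_iff[of x "?f x"] unfolding feasible_iff by (auto simp: diff_divide_distrib)
  \<comment> \<open>The parameter value 0 is an arbitrary choice in [0,1]; the point only witnesses
    that \<theta> is attained.\<close>
  define x\<^sub>0 :: "real ^ 2" where "x\<^sub>0 = vector
    [max (u1 0) (u2 0 + 2 * s) / 2 - max (u1 0 - 2 * t) (u2 0) / 2,
     max (u1 0) (u2 0 + 2 * s) / 2 + max (u1 0 - 2 * t) (u2 0) / 2]"
  have "x\<^sub>0 \<in> ?S \<and> ?f x\<^sub>0 \<le> \<theta>"
    unfolding sublevel x\<^sub>0_def vector_2 by (rule exI[of _ 0]) simp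
  then have "x\<^sub>0 \<in> ?S" "?f x\<^sub>0 \<le> \<theta>"
    by simp_all
  note minimum_value_and_minimizers_sublevel[where f = ?f, OF lower this]
  then show ?thesis
    unfolding sublevel by (rule conjI)
qed

end
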